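(* Let $\Psi=(E,\Delta)$ be an ordered simplicial complex in the class QC. If $B$ is a basis of $\Psi$ and $e\in E\setminus B$ is externally active with respect to $B$, then there is a unique circuit contained in $B\cup\{e\}$.
   Context: An ordered simplicial complex is a pair $\Psi=(E,\Delta)$ with $E$ a finite totally ordered set and $\Delta\subseteq 2^E$ a simplicial complex (closed under taking subsets, $\emptyset\in\Delta$). Elements of $\Delta$ are independent sets; inclusion-maximal ones are bases; inclusion-minimal subsets of $E$ not in $\Delta$ are circuits. QC: the class of $\Psi$ such that if $C_1\neq C_2$ are circuits and $c\in C_1\cap C_2$ satisfies $c<\max (C_1\triangle C_2)$ (symmetric difference), then there is a circuit $C_3\subseteq (C_1\cup C_2)\setminus\{c\}$. For a basis $B$, an element $e\in E\setminus B$ is externally active with respect to $B$ if there is a circuit $C\subseteq B\cup\{e\}$ whose smallest element is $e$. *)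

theory Defs
  imports Main
begin

text \<open>
  The total order on the ground set is the one inherited from the ambient linearly ordered type,
  which is an arbitrary type variable.
\<close>

definition ordered_simplicial_complex :: "'a::linorder set \<Rightarrow> 'a set set \<Rightarrow> bool" where
  "ordered_simplicial_complex E \<Delta> \<longleftrightarrow>
     finite E \<and> \<Delta> \<subseteq> Pow E \<and> {} \<in> \<Delta> \<and> (\<forall>S\<in>\<Delta>. \<forall>T. T \<subseteq> S \<longrightarrow> T \<in> \<Delta>)"

definition basis :: "'a set set \<Rightarrow> 'a set \<Rightarrow> bool" where
  "basis \<Delta> B \<longleftrightarrow> B \<in> \<Delta> \<and> (\<forall>S\<in>\<Delta>. B \<subseteq> S \<longrightarrow> S = B)"

definition circuit :: "'a set \<Rightarrow> 'a set set \<Rightarrow> 'a set \<Rightarrow> bool" where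
  "circuit E \<Delta> C \<longleftrightarrow> C \<subseteq> E \<and> C \<notin> \<Delta> \<and> (\<forall>D. D \<subseteq> E \<and> D \<notin> \<Delta> \<and> D \<subseteq> C \<longrightarrow> D = C)"

text \<open>
  \<open>Max\<close> below is applied to a finite set (subset of \<open>E\<close>) that is nonempty because
  \<open>C\<^sub>1 \<noteq> C\<^sub>2\<close>.
\<close>

definition QC :: "'a::linorder set \<Rightarrow> 'a set set \<Rightarrow> bool" where
  "QC E \<Delta> \<longleftrightarrow>
     ordered_simplicial_complex E \<Delta> \<and>
     (\<forall>C\<^sub>1 C\<^sub>2 c. circuit E \<Delta> C\<^sub>1 \<and> circuit E \<Delta> C\<^sub>2 \<and> C\<^sub>1 \<noteq> C\<^sub>2 \<and>
        c \<in> C\<^sub>1 \<inter> C\<^sub>2 \<and> c < Max (sym_diff C\<^sub>1 C\<^sub>2) \<longrightarrow>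
        (\<exists>C\<^sub>3. circuit E \<Delta> C\<^sub>3 \<and> C\<^sub>3 \<subseteq> (C\<^sub>1 \<union> C\<^sub>2) - {c}))"

text \<open>
  Circuits are finite and, since \<open>{} \<in> \<Delta>\<close>, nonempty, so \<open>Min C\<close> is the smallest element.
\<close>

definition externally_active :: "'a::linorder set \<Rightarrow> 'a set set \<Rightarrow> 'a set \<Rightarrow> 'a \<Rightarrow> bool" where
  "externally_active E \<Delta> B e \<longleftrightarrow>
     e \<in> E - B \<and> (\<exists>C. circuit E \<Delta> C \<and> C \<subseteq> B \<union> {e} \<and> Min C = e)"

end

(* The active circuit C and any other circuit D in B \<union> {e} both contain e, since B contains no
   circuit.  By minimality of D some x lies in C - D, and e = Min C gives e < x; so the elimination
   property QC applies at e and yields a circuit inside B, a contradiction. *)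
theory Submission
  imports Defs
begin

lemma circuit_not_subset_independent:
  assumes "ordered_simplicial_complex E \<Delta>" and "B \<in> \<Delta>" and "circuit E \<Delta> C"
  shows "\<not> C \<subseteq> B"
  using assms unfolding ordered_simplicial_complex_def circuit_def by blast

lemma circuit_antichain:
  assumes "circuit E \<Delta> C" and "circuit E \<Delta> D" and "C \<subseteq> D"
  shows "C = D"
  using assms unfolding circuit_def by blast

theorem theorem4p16:
  fixes E :: "'a::linorder set" and \<Delta> :: "'a set set" and B :: "'a set" and e :: 'a
  assumes "QC E \<Delta>"
    and "basis \<Delta> B"
    and "e \<in> E - B"
    and "externally_active E \<Delta> B e"
  shows "\<exists>!C. circuit E \<Delta> C \<and> C \<subseteq> B \<union> {e}"
proof -
  have complex: "ordered_simplicial_complex E \<Delta>"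
    using assms(1) unfolding QC_def by blast
  then have "finite E"
    unfolding ordered_simplicial_complex_def by blast
  have "B \<in> \<Delta>"
    using assms(2) unfolding basis_def by blast
  have no_circuit: "\<not> D \<subseteq> B" if "circuit E \<Delta> D" for D
    using circuit_not_subset_independent[OF complex \<open>B \<in> \<Delta>\<close> that] .
  obtain C where C: "circuit E \<Delta> C" "C \<subseteq> B \<union> {e}" "Min C = e"
    using assms(4) unfolding externally_active_def by blast
  \<comment> \<open>Finiteness makes \<open>Min\<close> and \<open>Max\<close> genuine extrema here;
    \<open>Min_le\<close> and \<open>Max_ge\<close> both require it.\<close>
  have finite_circuit: "finite D" if "circuit E \<Delta> D" for D
    using that \<open>finite E\<close> finite_subset unfolding circuit_def by blast
  have "D = C" if D: "circuit E \<Delta> D" "D \<subseteq> B \<union> {e}" for D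
  proof (rule ccontr)
    assume "D \<noteq> C"
    have e_in: "e \<in> C \<inter> D"
      using no_circuit[OF C(1)] no_circuit[OF D(1)] C(2) D(2) by blast
    \<comment> \<open>The witness is sought in \<open>C\<close> rather than in \<open>D\<close>,
      because \<open>Min C = e\<close> bounds only the elements of \<open>C\<close> from
      below.\<close>
    obtain x where x: "x \<in> C" "x \<notin> D"
      using circuit_antichain[OF C(1) D(1)] \<open>D \<noteq> C\<close> by blast
    have "e \<le> x"
      using Min_le[OF finite_circuit[OF C(1)] x(1)] C(3) by simp
    \<comment> \<open>Strict, since \<open>e\<close> lies in \<open>D\<close> and \<open>x\<close>
      does not.\<close>
    then have "e < x"
      using e_in x(2) by (metis IntD2 order_le_less)
    \<comment> \<open>\<open>x\<close> need not be the maximum: any element of the symmetric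
      difference above \<open>e\<close> puts \<open>Max\<close> above \<open>e\<close>.\<close>
    also have "x \<le> Max (sym_diff C D)"
      using x finite_circuit[OF C(1)] finite_circuit[OF D(1)] by (intro Max_ge) auto
    finally obtain C\<^sub>3 where "circuit E \<Delta> C\<^sub>3" "C\<^sub>3 \<subseteq> (C \<union> D) - {e}"
      using assms(1) C(1) D(1) \<open>D \<noteq> C\<close> e_in unfolding QC_def by metis
    \<comment> \<open>With \<open>e\<close> removed, \<open>C \<union> D\<close> lies inside
      \<open>B\<close>, hence so does \<open>C\<^sub>3\<close>.\<close>
    then show False
      using no_circuit C(2) D(2) by blast
  qed
  then show ?thesis
    using C by blast
qed

end
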